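(* Let $d\ge 2$, $\nu>0$, and let $f:[0,1]^D\to\mathbb{R}$ be bounded. Then $c_d>0$ and, for any $1\le j\le d$, $$\beta^f_j=c_d^{-1}\Bigl[\sigma_1\,\mathbb{E}[\pi f(x)]+\sigma_2\,\mathbb{E}[\pi z_j f(x)]+\sigma_3\sum_{\substack{k=1\\k\ne j}}^d\mathbb{E}[\pi z_k f(x)]\Bigr].$$
   Context: Setting (LIME for images). $\xi\in[0,1]^D$ is a fixed image with $D$ pixels. The superpixels $J_1,\dots,J_d$ are non-empty sets forming a partition of $\{1,\dots,D\}$. The replacement image $\bar\xi\in[0,1]^D$ is either constant equal to a given color, or the superpixel mean, $\bar\xi_u=\frac1{|J_k|}\sum_{v\in J_k}\xi_v$ for $u\in J_k$. Let $z=(z_1,\dots,z_d)$ be uniform on $\{0,1\}^d$ (i.i.d. Bernoulli($1/2$) coordinates); all expectations are with respect to $z$. The perturbed image $x\in[0,1]^D$ is $x_u=z_j\xi_u+(1-z_j)\bar\xi_u$ for $u\in J_j$. The weight is $\pi=\psi(S/d)$, where $S=\#\{j:z_j=0\}$ and $\psi(t)=\exp\left(\frac{-(1-\sqrt{1-t})^2}{2\nu^2}\right)$ for $t\in[0,1]$. Coefficients. $\alpha_0=\mathbb{E}[\pi]$ and $\alpha_p=\mathbb{E}[\pi z_1\cdots z_p]$ for $1\le p\le d$; $$c_d=(d-1)\alpha_0\alpha_2-d\alpha_1^2+\alpha_0\alpha_1,\qquad \sigma_1=-\alpha_1,$$ $$\sigma_2=\frac{(d-2)\alpha_0\alpha_2-(d-1)\alpha_1^2+\alpha_0\alpha_1}{\alpha_1-\alpha_2},\qquad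 \sigma_3=\frac{\alpha_1^2-\alpha_0\alpha_2}{\alpha_1-\alpha_2}.$$ Limit explanation. Write $\tilde z=(1,z_1,\dots,z_d)^\top\in\mathbb{R}^{d+1}$, $\Sigma=\mathbb{E}[\pi\tilde z\tilde z^\top]$ (an invertible matrix) and $\Gamma^f=\mathbb{E}[\pi f(x)\tilde z]$. Then $\beta^f=\Sigma^{-1}\Gamma^f\in\mathbb{R}^{d+1}$, with coordinates indexed by $0,1,\dots,d$ (coordinate $0$ is the intercept). It is the limit in probability, as the number of i.i.d. samples goes to infinity, of the weighted least-squares coefficients of $f(x)$ regressed on $\tilde z$ with weights $\pi$. *)

theory Defs
  imports
    "HOL-Probability.Probability"
    "Jordan_Normal_Form.Gauss_Jordan_Elimination"
    "Jordan_Normal_Form.Determinant"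
begin

unbundle no vec_syntax
hide_const (open) Finite_Cartesian_Product.vec Finite_Cartesian_Product.mat
  Finite_Cartesian_Product.transpose Finite_Cartesian_Product.row
  Finite_Cartesian_Product.column Determinants.det
hide_type (open) Finite_Cartesian_Product.vec

text \<open>Pixels are numbered \<open>1, \<dots>, D\<close> and superpixels \<open>1, \<dots>, d\<close>. The sets
  \<open>[0,1]\<^sup>D\<close> and \<open>{0,1}\<^sup>d\<close> are sets of extensional functions; the coordinates of \<open>z\<close> are
  real numbers, so that they can be used in arithmetic directly.\<close>

definition images :: "nat \<Rightarrow> (nat \<Rightarrow> real) set" where
  "images D = {1..D} \<rightarrow>\<^sub>E {0..1}"

definition superpixels :: "nat \<Rightarrow> nat \<Rightarrow> (nat \<Rightarrow> nat set) \<Rightarrow> bool" where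
  "superpixels d D J \<longleftrightarrow>
     (\<forall>j\<in>{1..d}. J j \<noteq> {}) \<and> disjoint_family_on J {1..d} \<and> (\<Union>j\<in>{1..d}. J j) = {1..D}"

definition constant_replacement :: "nat \<Rightarrow> (nat \<Rightarrow> real) \<Rightarrow> bool" where
  "constant_replacement D \<xi>' \<longleftrightarrow> (\<exists>c\<in>{0..1}. \<forall>u\<in>{1..D}. \<xi>' u = c)"

definition mean_replacement ::
  "nat \<Rightarrow> (nat \<Rightarrow> nat set) \<Rightarrow> (nat \<Rightarrow> real) \<Rightarrow> (nat \<Rightarrow> real) \<Rightarrow> bool" where
  "mean_replacement d J \<xi> \<xi>' \<longleftrightarrow>
     (\<forall>k\<in>{1..d}. \<forall>u\<in>J k. \<xi>' u = (\<Sum>v\<in>J k. \<xi> v) / real (card (J k)))"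

definition perturbed ::
  "nat \<Rightarrow> nat \<Rightarrow> (nat \<Rightarrow> nat set) \<Rightarrow> (nat \<Rightarrow> real) \<Rightarrow> (nat \<Rightarrow> real) \<Rightarrow> (nat \<Rightarrow> real) \<Rightarrow> nat \<Rightarrow> real"
  where "perturbed d D J \<xi> \<xi>' z =
    (\<lambda>u\<in>{1..D}. let j = (THE j. j \<in> {1..d} \<and> u \<in> J j) in z j * \<xi> u + (1 - z j) * \<xi>' u)"

definition mask_pmf :: "nat \<Rightarrow> (nat \<Rightarrow> real) pmf" where
  "mask_pmf d = pmf_of_set ({1..d} \<rightarrow>\<^sub>E {0, 1})"

abbreviation expect :: "nat \<Rightarrow> ((nat \<Rightarrow> real) \<Rightarrow> real) \<Rightarrow> real" where
  "expect d \<equiv> measure_pmf.expectation (mask_pmf d)"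

definition psi :: "real \<Rightarrow> real \<Rightarrow> real" where
  "psi \<nu> t = exp (- ((1 - sqrt (1 - t))\<^sup>2) / (2 * \<nu>\<^sup>2))"

definition weight :: "nat \<Rightarrow> real \<Rightarrow> (nat \<Rightarrow> real) \<Rightarrow> real" where
  "weight d \<nu> z = psi \<nu> (real (card {j\<in>{1..d}. z j = 0}) / real d)"

definition alpha :: "nat \<Rightarrow> real \<Rightarrow> nat \<Rightarrow> real" where
  "alpha d \<nu> p = expect d (\<lambda>z. weight d \<nu> z * (\<Prod>j=1..p. z j))"

definition c_coeff :: "nat \<Rightarrow> real \<Rightarrow> real" where
  "c_coeff d \<nu> = (real d - 1) * alpha d \<nu> 0 * alpha d \<nu> 2 - real d * (alpha d \<nu> 1)\<^sup>2
     + alpha d \<nu> 0 * alpha d \<nu> 1"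

definition sigma1 :: "nat \<Rightarrow> real \<Rightarrow> real" where
  "sigma1 d \<nu> = - alpha d \<nu> 1"

definition sigma2 :: "nat \<Rightarrow> real \<Rightarrow> real" where
  "sigma2 d \<nu> = ((real d - 2) * alpha d \<nu> 0 * alpha d \<nu> 2 - (real d - 1) * (alpha d \<nu> 1)\<^sup>2
     + alpha d \<nu> 0 * alpha d \<nu> 1) / (alpha d \<nu> 1 - alpha d \<nu> 2)"

definition sigma3 :: "nat \<Rightarrow> real \<Rightarrow> real" where
  "sigma3 d \<nu> = ((alpha d \<nu> 1)\<^sup>2 - alpha d \<nu> 0 * alpha d \<nu> 2) / (alpha d \<nu> 1 - alpha d \<nu> 2)"

definition ztilde :: "nat \<Rightarrow> (nat \<Rightarrow> real) \<Rightarrow> real vec" where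
  "ztilde d z = vec (d + 1) (\<lambda>i. if i = 0 then 1 else z i)"

definition Sigma_mat :: "nat \<Rightarrow> real \<Rightarrow> real mat" where
  "Sigma_mat d \<nu> = mat (d + 1) (d + 1)
     (\<lambda>(i, k). expect d (\<lambda>z. weight d \<nu> z * ztilde d z $ i * ztilde d z $ k))"

definition Gamma_vec ::
  "nat \<Rightarrow> real \<Rightarrow> ((nat \<Rightarrow> real) \<Rightarrow> nat \<Rightarrow> real) \<Rightarrow> ((nat \<Rightarrow> real) \<Rightarrow> real) \<Rightarrow> real vec" where
  "Gamma_vec d \<nu> x f = vec (d + 1)
     (\<lambda>i. expect d (\<lambda>z. weight d \<nu> z * f (x z) * ztilde d z $ i))"

text \<open>\<open>mat_inverse\<close> returns an option; it is not \<open>None\<close> here, see \<open>mat_inverse_Sigma_mat\<close>.\<close>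

definition beta ::
  "nat \<Rightarrow> real \<Rightarrow> ((nat \<Rightarrow> real) \<Rightarrow> nat \<Rightarrow> real) \<Rightarrow> ((nat \<Rightarrow> real) \<Rightarrow> real) \<Rightarrow> real vec" where
  "beta d \<nu> x f = the (mat_inverse (Sigma_mat d \<nu>)) *\<^sub>v Gamma_vec d \<nu> x f"

lemma finite_masks: "finite ({1..d::nat} \<rightarrow>\<^sub>E {0, 1 :: real})"
  by (rule finite_PiE) simp_all

lemma masks_nonempty: "({1..d::nat} \<rightarrow>\<^sub>E {0, 1 :: real}) \<noteq> {}"
  by (simp add: PiE_eq_empty_iff)

lemma expect_sum:
  "expect d g = (\<Sum>z\<in>{1..d} \<rightarrow>\<^sub>E {0, 1}. g z) / real (card ({1..d} \<rightarrow>\<^sub>E {0, 1 :: real}))"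
  unfolding mask_pmf_def by (rule integral_pmf_of_set[OF masks_nonempty finite_masks])

lemma weight_pos: "weight d \<nu> z > 0"
  by (simp add: weight_def psi_def)

lemma Sigma_mat_quadratic_form:
  assumes "v \<in> carrier_vec (d + 1)"
  shows "v \<bullet> (Sigma_mat d \<nu> *\<^sub>v v) = expect d (\<lambda>z. weight d \<nu> z * (ztilde d z \<bullet> v)\<^sup>2)"
proof -
  let ?E = "{1..d} \<rightarrow>\<^sub>E {0, 1 :: real}"
  let ?N = "real (card ?E)"
  define n where "n = Suc d"
  let ?I = "{0..<n}"
  have "v \<bullet> (Sigma_mat d \<nu> *\<^sub>v v) = (\<Sum>i\<in>?I. v $ i * (\<Sum>k\<in>?I.
      (\<Sum>z\<in>?E. weight d \<nu> z * ztilde d z $ i * ztilde d z $ k) / ?N * v $ k))"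
    using assms by (simp add: scalar_prod_def Sigma_mat_def expect_sum flip: n_def)
  also have "\<dots> = (\<Sum>i\<in>?I. \<Sum>k\<in>?I. \<Sum>z\<in>?E.
      weight d \<nu> z * (ztilde d z $ i * v $ i) * (ztilde d z $ k * v $ k) / ?N)"
    by (simp add: sum_distrib_left sum_distrib_right sum_divide_distrib mult_ac)
  also have "\<dots> = (\<Sum>z\<in>?E. \<Sum>i\<in>?I. \<Sum>k\<in>?I.
      weight d \<nu> z * (ztilde d z $ i * v $ i) * (ztilde d z $ k * v $ k) / ?N)"
    by (rule trans[OF sum.cong[OF refl sum.swap] sum.swap])
  also have "\<dots> = (\<Sum>z\<in>?E. weight d \<nu> z * (ztilde d z \<bullet> v)\<^sup>2 / ?N)"
  proof (rule sum.cong[OF refl])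
    fix z
    have "(ztilde d z \<bullet> v)\<^sup>2 = (\<Sum>i\<in>?I. \<Sum>k\<in>?I. (ztilde d z $ i * v $ i) * (ztilde d z $ k * v $ k))"
      using assms by (simp add: scalar_prod_def power2_eq_square sum_product flip: n_def)
    then show "(\<Sum>i\<in>?I. \<Sum>k\<in>?I. weight d \<nu> z * (ztilde d z $ i * v $ i) * (ztilde d z $ k * v $ k) / ?N)
        = weight d \<nu> z * (ztilde d z \<bullet> v)\<^sup>2 / ?N"
      by (simp only: sum_distrib_left sum_divide_distrib mult.assoc)
  qed
  also have "\<dots> = expect d (\<lambda>z. weight d \<nu> z * (ztilde d z \<bullet> v)\<^sup>2)"
    by (simp add: expect_sum sum_divide_distrib)
  finally show ?thesis .
qed

lemma mat_inverse_Sigma_mat: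
  obtains B where "mat_inverse (Sigma_mat d \<nu>) = Some B" "B \<in> carrier_mat (d + 1) (d + 1)"
    "Sigma_mat d \<nu> * B = 1\<^sub>m (d + 1)" "B * Sigma_mat d \<nu> = 1\<^sub>m (d + 1)"
proof -
  let ?E = "{1..d} \<rightarrow>\<^sub>E {0, 1 :: real}"
  let ?A = "Sigma_mat d \<nu>"
  have A: "?A \<in> carrier_mat (d + 1) (d + 1)"
    by (simp add: Sigma_mat_def)
  have "v = 0\<^sub>v (d + 1)" if v: "v \<in> carrier_vec (d + 1)" and "?A *\<^sub>v v = 0\<^sub>v (d + 1)" for v
  proof -
    have "expect d (\<lambda>z. weight d \<nu> z * (ztilde d z \<bullet> v)\<^sup>2) = 0"
      using that by (simp flip: Sigma_mat_quadratic_form[OF v])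
    moreover have "real (card ?E) \<noteq> 0"
      using finite_masks masks_nonempty by simp
    ultimately have "(\<Sum>z\<in>?E. weight d \<nu> z * (ztilde d z \<bullet> v)\<^sup>2) = 0"
      unfolding expect_sum by simp
    then have "\<forall>z\<in>?E. weight d \<nu> z * (ztilde d z \<bullet> v)\<^sup>2 = 0"
      by (subst (asm) sum_nonneg_eq_0_iff)
        (simp_all add: finite_masks less_imp_le[OF weight_pos] del: One_nat_def)
    then have *: "ztilde d z \<bullet> v = 0" if "z \<in> ?E" for z
      using that weight_pos[of d \<nu> z] by auto
    have sp: "ztilde d z \<bullet> v = v $ 0 + (\<Sum>i\<in>{1..d}. z i * v $ i)" for z
    proof -
      have "{0..<d+1} = insert 0 {1..d}" by auto
      then show ?thesis using v by (simp add: scalar_prod_def ztilde_def)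
    qed
    have v0: "v $ 0 = 0"
    proof -
      have "(\<lambda>i\<in>{1..d}. 0) \<in> ?E" by auto
      from *[OF this] show ?thesis by (simp add: sp)
    qed
    have "v $ i = 0" if i: "i \<in> {1..d}" for i
    proof -
      have "(\<lambda>k\<in>{1..d}. if k = i then 1 else 0) \<in> ?E" by auto
      from *[OF this] show ?thesis using i v0
        by (simp add: sp if_distrib[of "\<lambda>x. x * _"] sum.delta cong: if_cong)
    qed
    with v0 have "v $ i = 0" if "i < d + 1" for i
      using that by (cases "i = 0") auto
    with v show ?thesis by (intro eq_vecI) auto
  qed
  then have det: "det ?A \<noteq> 0"
    using det_0_iff_vec_prod_zero[OF A] by blast
  show ?thesis
  proof (cases "mat_inverse ?A")
    case None
    from mat_inverse(1)[OF A this, where b = "()"] det_non_zero_imp_unit[OF A det, where b = "()"]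
    show ?thesis by simp
  next
    case (Some B)
    with mat_inverse(2)[OF A] that show ?thesis by blast
  qed
qed

end

theory Submission
  imports Defs
begin

text \<open>
  Permuting the superpixels preserves the law of the mask and the weight, so \<open>\<Sigma>\<close> has only three
  distinct entries: \<open>\<alpha>\<^sub>0\<close> in the corner, \<open>\<alpha>\<^sub>1\<close> in the rest of the first row, the first column and
  the diagonal, and \<open>\<alpha>\<^sub>2\<close> elsewhere. Adding up the rows \<open>1, \<dots>, d\<close> of \<open>\<Sigma> \<beta> = \<Gamma>\<close> gives, with row
  \<open>0\<close>, a two-by-two system for \<open>\<beta>\<^sub>0\<close> and \<open>\<beta>\<^sub>1 + \<dots> + \<beta>\<^sub>d\<close> of determinant \<open>c\<^sub>d\<close>, and then row \<open>j\<close>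
  determines \<open>\<beta>\<^sub>j\<close>. Positivity of \<open>c\<^sub>d\<close> is that of the quadratic form of \<open>\<Sigma>\<close> at
  \<open>(-d \<alpha>\<^sub>1, \<alpha>\<^sub>0, \<dots>, \<alpha>\<^sub>0)\<close>, where its value is \<open>d \<alpha>\<^sub>0 c\<^sub>d\<close>.
\<close>

text \<open>This keeps the index \<open>1\<close> from becoming \<open>Suc 0\<close>, so that facts
  about \<open>z 1\<close> and \<open>alpha d \<nu> 1\<close> still match.\<close>

declare One_nat_def [simp del]

lemma expect_cong:
  assumes "\<And>z. z \<in> {1..d} \<rightarrow>\<^sub>E {0, 1} \<Longrightarrow> g z = h z"
  shows "expect d g = expect d h"
  unfolding expect_sum by (simp add: assms cong: sum.cong)

lemma expect_diff: "expect d (\<lambda>z. g z - h z) = expect d g - expect d h"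
  unfolding expect_sum by (simp add: sum_subtractf diff_divide_distrib)

text \<open>All masks have positive probability and weight, so a single mask with \<open>h\<close>
  positive suffices.\<close>

lemma expect_weight_pos:
  assumes nonneg: "\<And>z. z \<in> {1..d} \<rightarrow>\<^sub>E {0, 1} \<Longrightarrow> h z \<ge> 0"
    and a: "a \<in> {1..d} \<rightarrow>\<^sub>E {0, 1}" "h a > 0"
  shows "expect d (\<lambda>z. weight d \<nu> z * h z) > 0"
proof -
  have "(\<Sum>z\<in>{1..d} \<rightarrow>\<^sub>E {0, 1}. weight d \<nu> z * h z) > 0"
    using a weight_pos[of d \<nu>] nonneg
    by (intro sum_pos2[OF finite_masks, of a]) (auto intro: mult_nonneg_nonneg less_imp_le)
  moreover have "real (card ({1..d} \<rightarrow>\<^sub>E {0, 1 :: real})) > 0"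
    using finite_masks masks_nonempty by (simp add: card_gt_0_iff)
  ultimately show ?thesis
    unfolding expect_sum by simp
qed

section \<open>Symmetry under permutations of the superpixels\<close>

lemma comp_permutes_masks:
  assumes "p permutes {1..d}" "z \<in> {1..d} \<rightarrow>\<^sub>E B"
  shows "z \<circ> p \<in> {1..d} \<rightarrow>\<^sub>E B"
proof (rule PiE_I)
  show "(z \<circ> p) j \<in> B" if "j \<in> {1..d}" for j
    using assms that permutes_in_image[OF assms(1), of j] by (auto dest: PiE_mem)
  \<comment> \<open>Outside \<open>{1..d}\<close> the permutation is the identity, so extensionality
    survives.\<close>
  show "(z \<circ> p) j = undefined" if "j \<notin> {1..d}" for j
    using assms that permutes_not_in[OF assms(1), of j] by (auto dest: PiE_arb)
qed

lemma weight_comp_permutes: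
  assumes "p permutes {1..d}"
  shows "weight d \<nu> (z \<circ> p) = weight d \<nu> z"
proof -
  have "bij_betw p {j \<in> {1..d}. z (p j) = 0} {j \<in> {1..d}. z j = 0}"
  proof (rule bij_betw_imageI)
    show "inj_on p {j \<in> {1..d}. z (p j) = 0}"
      using permutes_inj[OF assms] by (rule inj_on_subset) simp
    show "p ` {j \<in> {1..d}. z (p j) = 0} = {j \<in> {1..d}. z j = 0}"
    proof (intro equalityI subsetI)
      fix j assume "j \<in> {j \<in> {1..d}. z j = 0}"
      moreover obtain i where "j = p i"
        using permutes_surj[OF assms] by blast
      ultimately show "j \<in> p ` {j \<in> {1..d}. z (p j) = 0}"
        using permutes_in_image[OF assms, of i] by auto
    qed (use permutes_in_image[OF assms] in auto)
  qed
  then show ?thesis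
    by (simp add: weight_def bij_betw_same_card)
qed

text \<open>The masks are equally likely, composition with \<open>p\<close> permutes them, and the
  weight depends only on the number of zeros.\<close>

lemma expect_weight_permute:
  assumes p: "p permutes {1..d}"
  shows "expect d (\<lambda>z. weight d \<nu> z * g (z \<circ> p)) = expect d (\<lambda>z. weight d \<nu> z * g z)"
proof -
  have "(\<Sum>z\<in>{1..d} \<rightarrow>\<^sub>E {0, 1}. weight d \<nu> z * g (z \<circ> p))
      = (\<Sum>z\<in>{1..d} \<rightarrow>\<^sub>E {0, 1}. weight d \<nu> z * g z)"
  proof (rule sum.reindex_bij_witness[where i = "\<lambda>z. z \<circ> inv_into UNIV p" and j = "\<lambda>z. z \<circ> p"])
  qed (simp_all add: comp_permutes_masks p permutes_inv weight_comp_permutes comp_assoc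
      permutes_inv_o[OF p])
  then show ?thesis
    unfolding expect_sum by simp
qed

section \<open>The moments \<alpha> of the mask\<close>

lemma alpha_0: "alpha d \<nu> 0 = expect d (weight d \<nu>)"
  by (simp add: alpha_def)

lemma alpha_1:
  assumes "i \<in> {1..d}"
  shows "expect d (\<lambda>z. weight d \<nu> z * z i) = alpha d \<nu> 1"
proof -
  have "Transposition.transpose 1 i permutes {1..d}"
    using assms by (intro permutes_swap_id) auto
  from expect_weight_permute[OF this, of \<nu> "\<lambda>z. z 1"] show ?thesis
    by (simp add: alpha_def)
qed

lemma alpha_2:
  assumes i: "i \<in> {1..d}" and k: "k \<in> {1..d}" and "i \<noteq> k"
  shows "expect d (\<lambda>z. weight d \<nu> z * (z i * z k)) = alpha d \<nu> 2"
proof -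
  define q where "q = Transposition.transpose 1 i"
  \<comment> \<open>The aim is \<open>p 1 = i\<close> and \<open>p 2 = k\<close>. The inner swap
    sends 2 to \<open>q k\<close>, which the involution \<open>q\<close> returns to
    \<open>k\<close>; it fixes 1 because \<open>q k\<close> differs from 1.\<close>
  define p where "p = q \<circ> Transposition.transpose 2 (q k)"
  have q: "q permutes {1..d}"
    unfolding q_def using i by (intro permutes_swap_id) auto
  have "q k \<in> {1..d}" "2 \<in> {1..d}"
    using permutes_in_image[OF q] i k \<open>i \<noteq> k\<close> by auto
  then have p: "p permutes {1..d}"
    unfolding p_def by (intro permutes_compose[OF _ q] permutes_swap_id)
  have "q k \<noteq> 1"
    using \<open>i \<noteq> k\<close> by (auto simp: q_def transpose_eq_iff)
  then have "p 1 = i" "p 2 = k"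
    by (simp_all add: p_def q_def transpose_apply_other)
  moreover have "{1..2} = {1, 2 :: nat}"
    by auto
  ultimately show ?thesis
    using expect_weight_permute[OF p, of \<nu> "\<lambda>z. z 1 * z 2"] by (simp add: alpha_def)
qed

lemma alpha_0_pos: "alpha d \<nu> 0 > 0"
proof -
  have "(\<lambda>i\<in>{1..d}. 0 :: real) \<in> {1..d} \<rightarrow>\<^sub>E {0, 1}"
    by auto
  from expect_weight_pos[OF _ this, of "\<lambda>_. 1"] show ?thesis
    by (simp add: alpha_0)
qed

lemma alpha_1_pos:
  assumes "d \<ge> 1"
  shows "alpha d \<nu> 1 > 0"
proof -
  have a: "(\<lambda>i\<in>{1..d}. 1 :: real) \<in> {1..d} \<rightarrow>\<^sub>E {0, 1}"
    by auto
  have nonneg: "z 1 \<ge> 0" if "z \<in> {1..d} \<rightarrow>\<^sub>E {0, 1 :: real}" for z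
    using PiE_mem[OF that, of 1] assms by auto
  have "expect d (\<lambda>z. weight d \<nu> z * z 1) > 0"
    using assms by (intro expect_weight_pos[OF nonneg a]) auto
  then show ?thesis
    using assms by (simp add: alpha_1)
qed

text \<open>The difference is the weighted mean of \<open>z 1 * (1 - z 2)\<close>, which is positive
  at the mask that keeps superpixel 1 only. This makes the denominators of \<open>sigma2\<close> and
  \<open>sigma3\<close> nonzero.\<close>

lemma alpha_2_less_alpha_1:
  assumes "d \<ge> 2"
  shows "alpha d \<nu> 2 < alpha d \<nu> 1"
proof -
  have a: "(\<lambda>i\<in>{1..d}. if i = 1 then 1 else 0 :: real) \<in> {1..d} \<rightarrow>\<^sub>E {0, 1}"
    by auto
  have nonneg: "z 1 * (1 - z 2) \<ge> 0" if "z \<in> {1..d} \<rightarrow>\<^sub>E {0, 1 :: real}" for z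
    using PiE_mem[OF that, of 1] PiE_mem[OF that, of 2] assms by auto
  have "expect d (\<lambda>z. weight d \<nu> z * (z 1 * (1 - z 2))) > 0"
    using assms by (intro expect_weight_pos[OF nonneg a]) auto
  also have "expect d (\<lambda>z. weight d \<nu> z * (z 1 * (1 - z 2)))
      = expect d (\<lambda>z. weight d \<nu> z * z 1 - weight d \<nu> z * (z 1 * z 2))"
    by (rule arg_cong[of _ _ "expect d"]) (simp add: algebra_simps)
  also have "\<dots> = alpha d \<nu> 1 - alpha d \<nu> 2"
    using assms by (simp add: expect_diff alpha_1 alpha_2)
  finally show ?thesis
    by simp
qed

section \<open>Entries and action of the matrix \<open>Sigma_mat\<close>\<close>

lemma Sigma_mat_carrier: "Sigma_mat d \<nu> \<in> carrier_mat (d + 1) (d + 1)"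
  by (simp add: Sigma_mat_def)

lemma Sigma_mat_entries:
  shows "Sigma_mat d \<nu> $$ (0, 0) = alpha d \<nu> 0"
    and "i \<in> {1..d} \<Longrightarrow> Sigma_mat d \<nu> $$ (0, i) = alpha d \<nu> 1"
    and "i \<in> {1..d} \<Longrightarrow> Sigma_mat d \<nu> $$ (i, 0) = alpha d \<nu> 1"
    and "i \<in> {1..d} \<Longrightarrow> k \<in> {1..d} \<Longrightarrow>
      Sigma_mat d \<nu> $$ (i, k) = (if i = k then alpha d \<nu> 1 else alpha d \<nu> 2)"
proof -
  show "Sigma_mat d \<nu> $$ (0, 0) = alpha d \<nu> 0"
    by (simp add: Sigma_mat_def ztilde_def alpha_0)
  show "Sigma_mat d \<nu> $$ (0, i) = alpha d \<nu> 1" "Sigma_mat d \<nu> $$ (i, 0) = alpha d \<nu> 1"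
    if "i \<in> {1..d}" for i
    using that alpha_1[OF that] by (simp_all add: Sigma_mat_def ztilde_def)
  show "Sigma_mat d \<nu> $$ (i, k) = (if i = k then alpha d \<nu> 1 else alpha d \<nu> 2)"
    if i: "i \<in> {1..d}" and k: "k \<in> {1..d}" for i k
  proof -
    have "Sigma_mat d \<nu> $$ (i, k) = expect d (\<lambda>z. weight d \<nu> z * (z i * z k))"
      using i k by (simp add: Sigma_mat_def ztilde_def mult.assoc)
    also have "\<dots> = (if i = k then alpha d \<nu> 1 else alpha d \<nu> 2)"
    proof (cases "i = k")
      case True
      \<comment> \<open>Coordinates in {0, 1} are idempotent, hence \<alpha>1 rather than a new
        moment on the diagonal.\<close>
      have "z i * z i = z i" if "z \<in> {1..d} \<rightarrow>\<^sub>E {0, 1 :: real}" for z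
        using PiE_mem[OF that i] by auto
      then have "expect d (\<lambda>z. weight d \<nu> z * (z i * z i)) = expect d (\<lambda>z. weight d \<nu> z * z i)"
        by (intro expect_cong) simp
      with True alpha_1[OF i] show ?thesis by simp
    qed (use i k in \<open>simp add: alpha_2\<close>)
    finally show ?thesis .
  qed
qed

text \<open>Index 0, the intercept, is split off. The product ranges over the dimension of its
  second factor, whence the condition on \<open>v\<close>.\<close>

lemma scalar_prod_Suc:
  assumes "v \<in> carrier_vec (d + 1)"
  shows "u \<bullet> v = u $ 0 * v $ 0 + (\<Sum>k\<in>{1..d}. u $ k * v $ k)"
proof -
  have "{0..<d + 1} = insert 0 {1..d}"
    by auto
  with assms show ?thesis
    by (simp add: scalar_prod_def)
qed

lemma Sigma_mat_mult_vec:
  assumes v: "v \<in> carrier_vec (d + 1)"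
  shows "(Sigma_mat d \<nu> *\<^sub>v v) $ 0 = alpha d \<nu> 0 * v $ 0 + alpha d \<nu> 1 * (\<Sum>k\<in>{1..d}. v $ k)"
    and "i \<in> {1..d} \<Longrightarrow> (Sigma_mat d \<nu> *\<^sub>v v) $ i = alpha d \<nu> 1 * v $ 0
      + (alpha d \<nu> 1 - alpha d \<nu> 2) * v $ i + alpha d \<nu> 2 * (\<Sum>k\<in>{1..d}. v $ k)"
proof -
  have row: "(Sigma_mat d \<nu> *\<^sub>v v) $ i = Sigma_mat d \<nu> $$ (i, 0) * v $ 0
      + (\<Sum>k\<in>{1..d}. Sigma_mat d \<nu> $$ (i, k) * v $ k)" if "i < d + 1" for i
    using that Sigma_mat_carrier[of d \<nu>] by (simp add: scalar_prod_Suc[OF v])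
  show "(Sigma_mat d \<nu> *\<^sub>v v) $ 0 = alpha d \<nu> 0 * v $ 0 + alpha d \<nu> 1 * (\<Sum>k\<in>{1..d}. v $ k)"
    by (subst row) (simp_all add: Sigma_mat_entries sum_distrib_left)
  assume i: "i \<in> {1..d}"
  \<comment> \<open>The row is the constant \<alpha>2 plus a correction \<alpha>1 - \<alpha>2 at the
    diagonal entry.\<close>
  have "(\<Sum>k\<in>{1..d}. Sigma_mat d \<nu> $$ (i, k) * v $ k)
      = (\<Sum>k\<in>{1..d}. (if i = k then (alpha d \<nu> 1 - alpha d \<nu> 2) * v $ k else 0)
          + alpha d \<nu> 2 * v $ k)"
    using i by (intro sum.cong) (simp_all add: Sigma_mat_entries left_diff_distrib)
  also have "\<dots> = (alpha d \<nu> 1 - alpha d \<nu> 2) * v $ i + alpha d \<nu> 2 * (\<Sum>k\<in>{1..d}. v $ k)"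
    using i by (simp add: sum.distrib sum_distrib_left)
  finally show "(Sigma_mat d \<nu> *\<^sub>v v) $ i = alpha d \<nu> 1 * v $ 0
      + (alpha d \<nu> 1 - alpha d \<nu> 2) * v $ i + alpha d \<nu> 2 * (\<Sum>k\<in>{1..d}. v $ k)"
    using row[of i] i by (simp add: Sigma_mat_entries)
qed

lemma c_coeff_pos:
  assumes "d \<ge> 1"
  shows "c_coeff d \<nu> > 0"
proof -
  \<comment> \<open>The intercept is chosen to cancel row 0; every other row then evaluates to
    \<open>c_coeff d \<nu>\<close>.\<close>
  define v where "v = vec (d + 1) (\<lambda>i. if i = 0 then - real d * alpha d \<nu> 1 else alpha d \<nu> 0)"
  have v: "v \<in> carrier_vec (d + 1)"
    by (simp add: v_def)
  have v0: "v $ 0 = - real d * alpha d \<nu> 1"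
    by (simp add: v_def)
  have vk: "v $ k = alpha d \<nu> 0" if "k \<in> {1..d}" for k
    using that by (simp add: v_def)
  have sv: "(\<Sum>k\<in>{1..d}. v $ k) = real d * alpha d \<nu> 0"
    by (simp add: vk)
  have Sv0: "(Sigma_mat d \<nu> *\<^sub>v v) $ 0 = 0"
    using assms by (simp add: Sigma_mat_mult_vec(1)[OF v] sv v0)
  have Svk: "(Sigma_mat d \<nu> *\<^sub>v v) $ k = c_coeff d \<nu>" if "k \<in> {1..d}" for k
    unfolding Sigma_mat_mult_vec(2)[OF v that] sv vk[OF that] v0 c_coeff_def
    by (simp add: algebra_simps power2_eq_square)
  have "Sigma_mat d \<nu> *\<^sub>v v \<in> carrier_vec (d + 1)"
    using Sigma_mat_carrier v by (rule mult_mat_vec_carrier)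
  then have "v \<bullet> (Sigma_mat d \<nu> *\<^sub>v v) = real d * alpha d \<nu> 0 * c_coeff d \<nu>"
    by (simp add: scalar_prod_Suc Sv0 Svk vk)
  moreover have "v \<bullet> (Sigma_mat d \<nu> *\<^sub>v v) > 0"
    unfolding Sigma_mat_quadratic_form[OF v]
  proof (rule expect_weight_pos)
    \<comment> \<open>At the zero mask only the intercept remains, and \<open>v $ 0\<close> is
      nonzero since \<alpha>1 > 0.\<close>
    show "(\<lambda>i\<in>{1..d}. 0 :: real) \<in> {1..d} \<rightarrow>\<^sub>E {0, 1}"
      by auto
    show "(ztilde d (\<lambda>i\<in>{1..d}. 0) \<bullet> v)\<^sup>2 > 0"
      using alpha_1_pos[OF assms, of \<nu>] assms
      by (simp add: scalar_prod_Suc[OF v] v0 ztilde_def)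
  qed simp
  ultimately show ?thesis
    using assms alpha_0_pos[of d \<nu>] by (simp add: zero_less_mult_iff mult_less_0_iff)
qed

section \<open>Solving the normal equations\<close>

lemma Sigma_mat_mult_beta: "Sigma_mat d \<nu> *\<^sub>v beta d \<nu> x f = Gamma_vec d \<nu> x f"
proof -
  obtain B where B: "mat_inverse (Sigma_mat d \<nu>) = Some B" "B \<in> carrier_mat (d + 1) (d + 1)"
      "Sigma_mat d \<nu> * B = 1\<^sub>m (d + 1)"
    by (rule mat_inverse_Sigma_mat)
  have G: "Gamma_vec d \<nu> x f \<in> carrier_vec (d + 1)"
    by (simp add: Gamma_vec_def)
  have "Sigma_mat d \<nu> *\<^sub>v beta d \<nu> x f = (Sigma_mat d \<nu> * B) *\<^sub>v Gamma_vec d \<nu> x f"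
    unfolding beta_def B(1) option.sel
    using assoc_mult_mat_vec[OF Sigma_mat_carrier B(2) G] by simp
  with B(3) G show ?thesis
    by simp
qed

lemma beta_carrier: "beta d \<nu> x f \<in> carrier_vec (d + 1)"
  by (rule mat_inverse_Sigma_mat[of d \<nu>]) (simp add: beta_def carrier_vecI)

text \<open>Keeping the factor \<open>c_coeff d \<nu>\<close> on the left lets the elimination
  proceed without dividing by it.\<close>

lemma c_coeff_mult_beta:
  fixes d :: nat and \<nu> :: real and x :: "(nat \<Rightarrow> real) \<Rightarrow> nat \<Rightarrow> real"
    and f :: "(nat \<Rightarrow> real) \<Rightarrow> real"
  assumes d: "d \<ge> 2" and j: "j \<in> {1..d}"
  defines "\<Gamma> \<equiv> Gamma_vec d \<nu> x f"
  shows "c_coeff d \<nu> * beta d \<nu> x f $ j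
    = sigma1 d \<nu> * \<Gamma> $ 0 + sigma2 d \<nu> * \<Gamma> $ j + sigma3 d \<nu> * (\<Sum>k\<in>{1..d} - {j}. \<Gamma> $ k)"
proof -
  define b where "b = beta d \<nu> x f"
  define T where "T = (\<Sum>k\<in>{1..d}. b $ k)"
  define G where "G = (\<Sum>k\<in>{1..d} - {j}. \<Gamma> $ k)"
  define a0 a1 a2 where a: "a0 = alpha d \<nu> 0" "a1 = alpha d \<nu> 1" "a2 = alpha d \<nu> 2"
  define c where "c = c_coeff d \<nu>"
  have c: "c = (real d - 1) * a0 * a2 - real d * a1\<^sup>2 + a0 * a1"
    by (simp add: c_def c_coeff_def a)
  have row0: "a0 * b $ 0 + a1 * T = \<Gamma> $ 0"
    using Sigma_mat_mult_vec(1)[OF beta_carrier[of d \<nu> x f], of \<nu>]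
    by (simp add: Sigma_mat_mult_beta \<Gamma>_def b_def T_def a)
  have row: "a1 * b $ 0 + (a1 - a2) * b $ k + a2 * T = \<Gamma> $ k" if "k \<in> {1..d}" for k
    using Sigma_mat_mult_vec(2)[OF beta_carrier[of d \<nu> x f] that, of \<nu>]
    by (simp add: Sigma_mat_mult_beta \<Gamma>_def b_def T_def a)
  have "\<Gamma> $ j + G = (\<Sum>k\<in>{1..d}. \<Gamma> $ k)"
    unfolding G_def using j by (simp add: sum.remove)
  also have "\<dots> = (\<Sum>k\<in>{1..d}. a1 * b $ 0 + (a1 - a2) * b $ k + a2 * T)"
    by (intro sum.cong) (simp_all add: row)
  also have "\<dots> = real d * a1 * b $ 0 + (a1 + (real d - 1) * a2) * T"
    by (simp add: sum.distrib T_def flip: sum_distrib_left) (simp add: algebra_simps)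
  finally have sum: "\<Gamma> $ j + G = real d * a1 * b $ 0 + (a1 + (real d - 1) * a2) * T" .
  \<comment> \<open>Cramer's rule for \<open>T\<close> in the system formed by \<open>row0\<close>
    and \<open>sum\<close>.\<close>
  have T: "c * T = a0 * (\<Gamma> $ j + G) - real d * a1 * \<Gamma> $ 0"
    unfolding c sum row0[symmetric] by (simp add: algebra_simps power2_eq_square)
  \<comment> \<open>The combination \<open>a0\<close> times row \<open>j\<close> minus
    \<open>a1\<close> times row 0 eliminates \<open>b $ 0\<close>.\<close>
  have bj: "a0 * (a1 - a2) * b $ j = a0 * \<Gamma> $ j - a1 * \<Gamma> $ 0 + (a1\<^sup>2 - a0 * a2) * T"
    unfolding row[OF j, symmetric] row0[symmetric] by (simp add: algebra_simps power2_eq_square)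
  have "a0 * ((a1 - a2) * (c * b $ j)) = c * (a0 * (a1 - a2) * b $ j)"
    by (simp add: mult_ac)
  also have "\<dots> = c * (a0 * \<Gamma> $ j - a1 * \<Gamma> $ 0) + (a1\<^sup>2 - a0 * a2) * (c * T)"
    unfolding bj by (simp add: algebra_simps)
  also have "\<dots> = c * (a0 * \<Gamma> $ j - a1 * \<Gamma> $ 0)
      + (a1\<^sup>2 - a0 * a2) * (a0 * (\<Gamma> $ j + G) - real d * a1 * \<Gamma> $ 0)"
    by (simp only: T)
  \<comment> \<open>After expanding \<open>c\<close>, all coefficients share the factor
    \<open>a0\<close>; that of \<open>\<Gamma> $ 0\<close> also contains \<open>a1 - a2\<close>,
    which is why \<open>sigma1\<close> has no denominator.\<close>
  also have "\<dots> = a0 * (- a1 * (a1 - a2) * \<Gamma> $ 0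
      + ((real d - 2) * a0 * a2 - (real d - 1) * a1\<^sup>2 + a0 * a1) * \<Gamma> $ j
      + (a1\<^sup>2 - a0 * a2) * G)"
    unfolding c by (simp add: algebra_simps power2_eq_square)
  finally have "(a1 - a2) * (c * b $ j) = - a1 * (a1 - a2) * \<Gamma> $ 0
      + ((real d - 2) * a0 * a2 - (real d - 1) * a1\<^sup>2 + a0 * a1) * \<Gamma> $ j
      + (a1\<^sup>2 - a0 * a2) * G"
    using alpha_0_pos[of d \<nu>] by (simp add: a)
  moreover have "a1 - a2 \<noteq> 0"
    using alpha_2_less_alpha_1[OF d, of \<nu>] by (simp add: a)
  ultimately have "c * b $ j = - a1 * \<Gamma> $ 0
      + ((real d - 2) * a0 * a2 - (real d - 1) * a1\<^sup>2 + a0 * a1) / (a1 - a2) * \<Gamma> $ j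
      + (a1\<^sup>2 - a0 * a2) / (a1 - a2) * G"
    by (simp add: divide_simps) (simp add: algebra_simps)
  then show ?thesis
    by (simp add: c_def b_def G_def a sigma1_def sigma2_def sigma3_def)
qed

theorem proposition2:
  fixes d D :: nat and \<nu> :: real and J :: "nat \<Rightarrow> nat set"
    and \<xi> \<xi>' :: "nat \<Rightarrow> real" and f :: "(nat \<Rightarrow> real) \<Rightarrow> real"
  defines "x \<equiv> perturbed d D J \<xi> \<xi>'"
  assumes "d \<ge> 2" and "\<nu> > 0"
    and "superpixels d D J"
    and "\<xi> \<in> images D" and "\<xi>' \<in> images D"
    and "constant_replacement D \<xi>' \<or> mean_replacement d J \<xi> \<xi>'"
    and "bounded (f ` images D)"
  shows "c_coeff d \<nu> > 0 \<and>
    (\<forall>j\<in>{1..d}. beta d \<nu> x f $ j = inverse (c_coeff d \<nu>) *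
       (sigma1 d \<nu> * expect d (\<lambda>z. weight d \<nu> z * f (x z))
        + sigma2 d \<nu> * expect d (\<lambda>z. weight d \<nu> z * z j * f (x z))
        + sigma3 d \<nu> * (\<Sum>k\<in>{1..d} - {j}. expect d (\<lambda>z. weight d \<nu> z * z k * f (x z)))))"
proof (intro conjI ballI)
  show c: "c_coeff d \<nu> > 0"
    using \<open>d \<ge> 2\<close> by (intro c_coeff_pos) simp
  fix j assume j: "j \<in> {1..d}"
  \<comment> \<open>Coordinate 0 of \<open>ztilde d z\<close> is 1 and coordinate \<open>k\<close>
    is \<open>z k\<close>, so the entries of \<open>Gamma_vec\<close> are the expectations in the
    formula.\<close>
  have G0: "Gamma_vec d \<nu> x f $ 0 = expect d (\<lambda>z. weight d \<nu> z * f (x z))"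
    by (simp add: Gamma_vec_def ztilde_def)
  have Gk: "Gamma_vec d \<nu> x f $ k = expect d (\<lambda>z. weight d \<nu> z * z k * f (x z))"
    if "k \<in> {1..d}" for k
    using that by (simp add: Gamma_vec_def ztilde_def mult_ac)
  have "beta d \<nu> x f $ j = inverse (c_coeff d \<nu>) * (c_coeff d \<nu> * beta d \<nu> x f $ j)"
    using c by simp
  also note c_coeff_mult_beta[OF \<open>d \<ge> 2\<close> j]
  finally show "beta d \<nu> x f $ j = inverse (c_coeff d \<nu>) *
       (sigma1 d \<nu> * expect d (\<lambda>z. weight d \<nu> z * f (x z))
        + sigma2 d \<nu> * expect d (\<lambda>z. weight d \<nu> z * z j * f (x z))
        + sigma3 d \<nu> * (\<Sum>k\<in>{1..d} - {j}. expect d (\<lambda>z. weight d \<nu> z * z k * f (x z))))"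
    using j by (simp add: G0 Gk)
qed

end
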